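(* Let $G$ be a bi-directed graph with finite vertex set $V$ and let $G^{\min}$ be a minimally oriented graph of $G$. Then there exists a total order $\le$ on $V$, extending the partial order $\preccurlyeq_B$, such that $G^{\min}=G^{\min}_<$, where $G^{\min}_<$ is the graph obtained from $G$ and $\le$ by the construction described in the context.
   Context: A simple mixed graph $G=(V,E)$ has a finite vertex set $V$ and at most one edge between any two distinct vertices (no loops), each edge being undirected ($v-w$), directed ($v\to w$ or $v\leftarrow w$), or bi-directed ($v\leftrightarrow w$). An edge $v\leftarrow w$ or $v\leftrightarrow w$ has an arrowhead at $v$; an edge $v\to w$ or $v-w$ has a tail at $v$. A bi-directed (undirected, directed) graph has only bi-directed (undirected, directed) edges. Vertices are adjacent if joined by an edge of any type; $\mathrm{Bd}(v)$ is the set consisting of $v$ and all vertices adjacent to $v$. A path is a sequence of distinct vertices with consecutive ones adjacent. $v$ is an ancestor of $w$ if $v=w$ or there is a directed path $v\to\cdots\to w$; $\mathrm{An}(C)$ is the set of ancestors of elements of $C$. Ancestral graph: a simple mixed graph such that (i) there are no directed cycles; (ii) if $v-w\in G$ then there is no $u$ with $u\to v\in G$ or $u\leftrightarrow v\in G$; (iii) if $v\leftrightarrow w\in G$ then $v$ is not an ancestor of $w$. m-separation: a non-endpoint vertex on a path is a collider if both path edges at it have an arrowhead at it, otherwise a non-collider. A path between $v$ and $w$ is $m$-connecting given $C\subseteq V\setminus\{v,w\}$ if every non-collider on it is not in $C$ and every collider on it is in $\mathrm{An}(C)$. $v,w$ are $m$-separated given $C$ if no path $m$-connects them given $C$; disjoint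 non-empty sets $A,B$ are $m$-separated given $C\subseteq V\setminus(A\cup B)$ if every $v\in A$ and $w\in B$ are. An ancestral graph is maximal if for every pair of distinct non-adjacent vertices $v,w$ there is some $C\subseteq V\setminus\{v,w\}$ such that $v,w$ are $m$-separated given $C$. Two ancestral graphs on the same vertex set are Markov equivalent if they have the same $m$-separations (the same triples $(A,B,C)$ with $A,B$ $m$-separated given $C$). Minimally oriented graph of a bi-directed graph $G$: a graph $G^{\min}$ such that (i) $G^{\min}$ is a maximal ancestral graph; (ii) $G$ and $G^{\min}$ are Markov equivalent; (iii) $G^{\min}$ has the minimum number of arrowheads among all maximal ancestral graphs Markov equivalent to $G$, where the number of arrowheads of a graph with $d$ directed and $b$ bi-directed edges is $d+2b$. Simplicial graph: a vertex $v$ is simplicial if every two distinct vertices of $\mathrm{Bd}(v)$ are adjacent. Dropping the arrowhead at $v$ means replacing $v\leftarrow w$ by $v-w$, or $v\leftrightarrow w$ by $v\to w$. The simplicial graph $G^s$ of a bi-directed graph $G$ is obtained by dropping all arrowheads at simplicial vertices of $G$. Partial order: $v\preccurlyeq_B w$ iff $v=w$ or $\mathrm{Bd}(v)\subsetneq\mathrm{Bd}(w)$ in $G$. A total order $\le$ extends it if $\mathrm{Bd}(v)\subsetneq\mathrm{Bd}(w)$ implies $v<w$. Construction of $G^{\min}_<$ (for a total order $\le$ extending $\preccurlyeq_B$): start with $G^s$ and replace every bi-directed edge $v\leftrightarrow w$ of $G^s$ with $\mathrm{Bd}(v)\subseteq\mathrm{Bd}(w)$ and $v<w$ by the directed edge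 $v\to w$. *)

theory Defs
  imports Main
begin

text \<open>
  Undirected and bi-directed edges are two-element vertex sets, a directed edge
  \<open>v \<rightarrow> w\<close> is the pair \<open>(v, w)\<close>.
\<close>

record 'a mixed_graph =
  verts :: "'a set"
  und :: "'a set set"
  dir :: "('a \<times> 'a) set"
  bid :: "'a set set"

definition simple_mixed_graph :: "'a mixed_graph \<Rightarrow> bool" where
  "simple_mixed_graph G \<longleftrightarrow>
     finite (verts G) \<and>
     und G \<subseteq> {{v, w} | v w. v \<in> verts G \<and> w \<in> verts G \<and> v \<noteq> w} \<and>
     bid G \<subseteq> {{v, w} | v w. v \<in> verts G \<and> w \<in> verts G \<and> v \<noteq> w} \<and>
     dir G \<subseteq> {(v, w) | v w. v \<in> verts G \<and> w \<in> verts G \<and> v \<noteq> w} \<and>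
     und G \<inter> bid G = {} \<and>
     (\<forall>v w. (v, w) \<in> dir G \<longrightarrow> (w, v) \<notin> dir G \<and> {v, w} \<notin> und G \<and> {v, w} \<notin> bid G)"

definition bidirected_graph :: "'a mixed_graph \<Rightarrow> bool" where
  "bidirected_graph G \<longleftrightarrow> simple_mixed_graph G \<and> und G = {} \<and> dir G = {}"

definition adjacent :: "'a mixed_graph \<Rightarrow> 'a \<Rightarrow> 'a \<Rightarrow> bool" where
  "adjacent G v w \<longleftrightarrow>
     {v, w} \<in> und G \<or> (v, w) \<in> dir G \<or> (w, v) \<in> dir G \<or> {v, w} \<in> bid G"

definition Bd :: "'a mixed_graph \<Rightarrow> 'a \<Rightarrow> 'a set" where
  "Bd G v = insert v {w. adjacent G v w}"

definition ancestor :: "'a mixed_graph \<Rightarrow> 'a \<Rightarrow> 'a \<Rightarrow> bool" where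
  "ancestor G v w \<longleftrightarrow> (v, w) \<in> (dir G)\<^sup>*"

definition An :: "'a mixed_graph \<Rightarrow> 'a set \<Rightarrow> 'a set" where
  "An G C = {v. \<exists>w \<in> C. ancestor G v w}"

definition ancestral :: "'a mixed_graph \<Rightarrow> bool" where
  "ancestral G \<longleftrightarrow>
     simple_mixed_graph G \<and>
     acyclic (dir G) \<and>
     (\<forall>v w. {v, w} \<in> und G \<longrightarrow> \<not> (\<exists>u. (u, v) \<in> dir G \<or> {u, v} \<in> bid G)) \<and>
     (\<forall>v w. {v, w} \<in> bid G \<longrightarrow> \<not> ancestor G v w)"

definition is_path :: "'a mixed_graph \<Rightarrow> 'a \<Rightarrow> 'a list \<Rightarrow> 'a \<Rightarrow> bool" where
  "is_path G v p w \<longleftrightarrow>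
     p \<noteq> [] \<and> hd p = v \<and> last p = w \<and> set p \<subseteq> verts G \<and> distinct p \<and>
     successively (adjacent G) p"

text \<open>The edge between \<open>u\<close> and \<open>v\<close> has an arrowhead at \<open>v\<close>.\<close>

definition into :: "'a mixed_graph \<Rightarrow> 'a \<Rightarrow> 'a \<Rightarrow> bool" where
  "into G u v \<longleftrightarrow> (u, v) \<in> dir G \<or> {u, v} \<in> bid G"

definition collider :: "'a mixed_graph \<Rightarrow> 'a \<Rightarrow> 'a \<Rightarrow> 'a \<Rightarrow> bool" where
  "collider G u v w \<longleftrightarrow> into G u v \<and> into G w v"

definition m_connecting :: "'a mixed_graph \<Rightarrow> 'a set \<Rightarrow> 'a \<Rightarrow> 'a list \<Rightarrow> 'a \<Rightarrow> bool" where
  "m_connecting G C v p w \<longleftrightarrow>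
     is_path G v p w \<and>
     (\<forall>i. Suc (Suc i) < length p \<longrightarrow>
        (\<not> collider G (p ! i) (p ! Suc i) (p ! Suc (Suc i)) \<longrightarrow> p ! Suc i \<notin> C) \<and>
        (collider G (p ! i) (p ! Suc i) (p ! Suc (Suc i)) \<longrightarrow> p ! Suc i \<in> An G C))"

text \<open>Only meant for distinct vertices \<open>v\<close>, \<open>w\<close> and \<open>C \<subseteq> verts G - {v, w}\<close>.\<close>

definition m_separated_vertices :: "'a mixed_graph \<Rightarrow> 'a \<Rightarrow> 'a \<Rightarrow> 'a set \<Rightarrow> bool" where
  "m_separated_vertices G v w C \<longleftrightarrow> \<not> (\<exists>p. m_connecting G C v p w)"

definition m_separated :: "'a mixed_graph \<Rightarrow> 'a set \<Rightarrow> 'a set \<Rightarrow> 'a set \<Rightarrow> bool" where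
  "m_separated G A B C \<longleftrightarrow>
     A \<noteq> {} \<and> B \<noteq> {} \<and> A \<subseteq> verts G \<and> B \<subseteq> verts G \<and> A \<inter> B = {} \<and>
     C \<subseteq> verts G - (A \<union> B) \<and>
     (\<forall>v \<in> A. \<forall>w \<in> B. m_separated_vertices G v w C)"

definition maximal_ancestral :: "'a mixed_graph \<Rightarrow> bool" where
  "maximal_ancestral G \<longleftrightarrow>
     ancestral G \<and>
     (\<forall>v \<in> verts G. \<forall>w \<in> verts G. v \<noteq> w \<and> \<not> adjacent G v w \<longrightarrow>
        (\<exists>C \<subseteq> verts G - {v, w}. m_separated_vertices G v w C))"

definition markov_equivalent :: "'a mixed_graph \<Rightarrow> 'a mixed_graph \<Rightarrow> bool" where
  "markov_equivalent G H \<longleftrightarrow>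
     verts G = verts H \<and> (\<forall>A B C. m_separated G A B C \<longleftrightarrow> m_separated H A B C)"

definition num_arrowheads :: "'a mixed_graph \<Rightarrow> nat" where
  "num_arrowheads G = card (dir G) + 2 * card (bid G)"

definition minimally_oriented :: "'a mixed_graph \<Rightarrow> 'a mixed_graph \<Rightarrow> bool" where
  "minimally_oriented G H \<longleftrightarrow>
     maximal_ancestral H \<and> markov_equivalent G H \<and>
     (\<forall>H'. maximal_ancestral H' \<and> markov_equivalent G H' \<longrightarrow>
        num_arrowheads H \<le> num_arrowheads H')"

definition simplicial :: "'a mixed_graph \<Rightarrow> 'a \<Rightarrow> bool" where
  "simplicial G v \<longleftrightarrow>
     v \<in> verts G \<and> (\<forall>u \<in> Bd G v. \<forall>w \<in> Bd G v. u \<noteq> w \<longrightarrow> adjacent G u w)"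

text \<open>Drop every arrowhead at a vertex of \<open>S\<close>.\<close>

definition drop_arrowheads :: "'a mixed_graph \<Rightarrow> 'a set \<Rightarrow> 'a mixed_graph" where
  "drop_arrowheads G S =
     \<lparr>verts = verts G,
      und = und G \<union> {{v, w} | v w. (v, w) \<in> dir G \<and> w \<in> S}
                  \<union> {{v, w} | v w. {v, w} \<in> bid G \<and> v \<in> S \<and> w \<in> S},
      dir = {(v, w). (v, w) \<in> dir G \<and> w \<notin> S}
          \<union> {(v, w). {v, w} \<in> bid G \<and> v \<in> S \<and> w \<notin> S},
      bid = {{v, w} | v w. {v, w} \<in> bid G \<and> v \<notin> S \<and> w \<notin> S}\<rparr>"

definition simplicial_graph :: "'a mixed_graph \<Rightarrow> 'a mixed_graph" where
  "simplicial_graph G = drop_arrowheads G {v. simplicial G v}"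

definition boundary_order :: "'a mixed_graph \<Rightarrow> 'a rel" where
  "boundary_order G =
     {(v, w). v \<in> verts G \<and> w \<in> verts G \<and> (v = w \<or> Bd G v \<subset> Bd G w)}"

definition total_extension :: "'a mixed_graph \<Rightarrow> 'a rel \<Rightarrow> bool" where
  "total_extension G r \<longleftrightarrow> linear_order_on (verts G) r \<and> boundary_order G \<subseteq> r"

lemma total_extension_iff:
  "total_extension G r \<longleftrightarrow>
     linear_order_on (verts G) r \<and>
     (\<forall>v \<in> verts G. \<forall>w \<in> verts G. Bd G v \<subset> Bd G w \<longrightarrow> (v, w) \<in> r \<and> v \<noteq> w)"
  unfolding total_extension_def boundary_order_def order_on_defs refl_on_def by blast

definition newly_directed :: "'a mixed_graph \<Rightarrow> 'a rel \<Rightarrow> 'a rel" where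
  "newly_directed G r =
     {(v, w). {v, w} \<in> bid (simplicial_graph G) \<and> Bd G v \<subseteq> Bd G w \<and>
              (v, w) \<in> r \<and> v \<noteq> w}"

definition Gmin :: "'a mixed_graph \<Rightarrow> 'a rel \<Rightarrow> 'a mixed_graph" where
  "Gmin G r = (let Gs = simplicial_graph G; E = newly_directed G r in
     \<lparr>verts = verts Gs,
      und = und Gs,
      dir = dir Gs \<union> E,
      bid = bid Gs - {{v, w} | v w. (v, w) \<in> E}\<rparr>)"

end

theory Submission
  imports Defs
begin

text \<open>
  Write \<open>K\<close> for the graph constructed from \<open>G\<close> and \<open>r\<close>. In a bi-directed graph \<open>v\<close> and \<open>w\<close> are connected given \<open>C\<close> iff they are connected
  through \<open>C\<close>. Hence non-adjacent vertices are separated given the empty set, so every Markov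
  equivalent maximal ancestral graph \<open>H\<close> has the adjacencies of \<open>G\<close>, and its unshielded triples are
  colliders. Consequently a tail at \<open>v\<close> on an edge of \<open>H\<close> between \<open>v\<close> and \<open>w\<close> forces
  \<open>Bd v \<subseteq> Bd w\<close>, and an undirected edge joins simplicial vertices. If \<open>r\<close> extends both
  strict inclusion of boundaries and the directed edges of \<open>H\<close>, every arrowhead of \<open>K\<close> is thus an
  arrowhead of \<open>H\<close>. As \<open>K\<close> is itself a maximal ancestral graph Markov equivalent to \<open>G\<close>,
  minimality of \<open>H\<close> forces \<open>H = K\<close>.
\<close>

section \<open>Walks\<close>

text \<open>Three-term analogue of \<open>successively\<close>, for conditions on an inner vertex
  together with its two neighbours. Shorter lists have no inner vertex and satisfy it
  vacuously.\<close>

fun triplewise :: "('a \<Rightarrow> 'a \<Rightarrow> 'a \<Rightarrow> bool) \<Rightarrow> 'a list \<Rightarrow> bool" where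
  "triplewise P (a # b # c # xs) \<longleftrightarrow> P a b c \<and> triplewise P (b # c # xs)"
| "triplewise P _ \<longleftrightarrow> True"

text \<open>The overlap in \<open>a, b\<close> is what puts every window of three into one of the
  parts. This allows local surgery on walks.\<close>

lemma triplewise_append:
  "triplewise P (xs @ a # b # ys) \<longleftrightarrow> triplewise P (xs @ [a, b]) \<and> triplewise P (a # b # ys)"
proof (induction xs)
  case (Cons x xs)
  then show ?case by (cases xs; cases "tl xs") auto
qed simp

lemma triplewise_iff_nth:
  "triplewise P xs \<longleftrightarrow>
     (\<forall>i. Suc (Suc i) < length xs \<longrightarrow> P (xs ! i) (xs ! Suc i) (xs ! Suc (Suc i)))"
proof (induction P xs rule: triplewise.induct)
  case (1 P a b c xs)
  have all_nat: "(\<forall>i. Q i) \<longleftrightarrow> Q 0 \<and> (\<forall>i. Q (Suc i))" for Q :: "nat \<Rightarrow> bool"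
    by (metis nat.exhaust)
  show ?case by (subst all_nat) (simp add: 1)
qed auto

lemma not_triplewiseE:
  assumes "\<not> triplewise P xs"
  obtains as a x b bs where "xs = as @ a # x # b # bs" "\<not> P a x b"
proof -
  have "\<exists>as a x b bs. xs = as @ a # x # b # bs \<and> \<not> P a x b"
    using assms
  proof (induction P xs rule: triplewise.induct)
    case (1 P a b c xs)
    show ?case
    proof (cases "P a b c")
      case True
      then have "\<exists>as a' x b' bs. b # c # xs = as @ a' # x # b' # bs \<and> \<not> P a' x b'"
        using 1 by simp
      then show ?thesis by (metis append_Cons)
    next
      case False
      then show ?thesis by blast
    qed
  qed auto
  then show ?thesis using that by blast
qed

text \<open>The relation is arbitrary because walks are needed both along adjacency and along the
  reflexive relation of membership in \<open>Bd\<close>.\<close>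

definition walk :: "('a \<Rightarrow> 'a \<Rightarrow> bool) \<Rightarrow> 'a \<Rightarrow> 'a list \<Rightarrow> 'a \<Rightarrow> bool" where
  "walk R v p w \<longleftrightarrow> p \<noteq> [] \<and> hd p = v \<and> last p = w \<and> successively R p"

lemma walk_shortcut:
  assumes "walk R v (as @ a # xs @ b # bs) w" "R a b"
  shows "walk R v (as @ a # b # bs) w"
  using assms by (cases as) (auto simp: walk_def successively_append_iff successively_Cons hd_append
      split: if_splits)

lemma walk_cut_cycle:
  assumes "walk R v (as @ a # xs @ a # bs) w"
  shows "walk R v (as @ a # bs) w"
  using assms by (cases as) (auto simp: walk_def successively_append_iff successively_Cons hd_append
      split: if_splits)

abbreviation connected_within :: "('a \<Rightarrow> 'a \<Rightarrow> bool) \<Rightarrow> 'a set \<Rightarrow> 'a \<Rightarrow> 'a \<Rightarrow> bool" where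
  "connected_within E U v w \<equiv> (v, w) \<in> {(x, y). E x y \<and> x \<in> U \<and> y \<in> U}\<^sup>*"

lemma connected_within_imp_walk:
  assumes "connected_within E U v w" "v \<in> U"
  shows "\<exists>p. walk E v p w \<and> set p \<subseteq> U"
  using assms
proof (induction rule: rtrancl_induct)
  case base
  then show ?case by (auto simp: walk_def intro!: exI[of _ "[v]"])
next
  case (step y z)
  then obtain p where "walk E v p y" "set p \<subseteq> U" by blast
  with step.hyps show ?case
    by (intro exI[of _ "p @ [z]"]) (auto simp: walk_def successively_append_iff)
qed

text \<open>A shortest walk works: a repeated vertex or a chord across one inner vertex would give a
  shorter one.\<close>

lemma connected_within_imp_induced_path:
  assumes "connected_within E U v w" "v \<in> U"
  obtains p where "walk E v p w" "set p \<subseteq> U" "distinct p" "triplewise (\<lambda>a x b. \<not> E a b) p"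
proof -
  let ?P = "\<lambda>p. walk E v p w \<and> set p \<subseteq> U"
  obtain p where p: "?P p" and least: "\<And>q. ?P q \<Longrightarrow> length p \<le> length q"
    using ex_has_least_nat[of ?P _ length] connected_within_imp_walk[OF assms] by blast
  have "distinct p"
  proof (rule ccontr)
    assume "\<not> distinct p"
    then obtain as a xs bs where eq: "p = as @ a # xs @ a # bs"
      using not_distinct_decomp by fastforce
    then have "?P (as @ a # bs)" using p walk_cut_cycle by fastforce
    from least[OF this] eq show False by simp
  qed
  moreover have "triplewise (\<lambda>a x b. \<not> E a b) p"
  proof (rule ccontr)
    assume "\<not> triplewise (\<lambda>a x b. \<not> E a b) p"
    then obtain as a x b bs where eq: "p = as @ a # x # b # bs" and "E a b"
      by (elim not_triplewiseE) simp
    then have "?P (as @ a # b # bs)" using p walk_shortcut[of E v as a "[x]" b bs w] by auto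
    from least[OF this] eq show False by simp
  qed
  ultimately show ?thesis using p that by blast
qed

section \<open>Mixed graphs\<close>

lemma adjacent_commute: "adjacent M v w \<longleftrightarrow> adjacent M w v"
  by (auto simp: adjacent_def insert_commute)

lemma mem_Bd_commute: "v \<in> Bd M w \<longleftrightarrow> w \<in> Bd M v"
  by (auto simp: Bd_def adjacent_commute)

lemma adjacent_verts:
  assumes "simple_mixed_graph M" "adjacent M v w"
  shows "v \<in> verts M" "w \<in> verts M" "v \<noteq> w"
  using assms unfolding simple_mixed_graph_def adjacent_def by (auto simp: doubleton_eq_iff)

lemma m_connecting_iff_triplewise:
  "m_connecting M C v p w \<longleftrightarrow>
     walk (adjacent M) v p w \<and> set p \<subseteq> verts M \<and> distinct p \<and>
     triplewise (\<lambda>a x b. if collider M a x b then x \<in> An M C else x \<notin> C) p"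
  unfolding m_connecting_def is_path_def triplewise_iff_nth walk_def by auto

lemma m_connecting_edge:
  assumes "simple_mixed_graph M" "adjacent M v w"
  shows "m_connecting M C v [v, w] w"
  using assms adjacent_verts[OF assms] by (auto simp: m_connecting_iff_triplewise walk_def)

lemma m_connecting_noncollider:
  assumes "simple_mixed_graph M" "adjacent M v x" "adjacent M x w" "v \<noteq> w" "\<not> collider M v x w"
  shows "m_connecting M {} v [v, x, w] w"
  using assms adjacent_verts[OF assms(1,2)] adjacent_verts[OF assms(1,3)]
  by (auto simp: m_connecting_iff_triplewise walk_def)

lemma m_separated_singleton:
  assumes "v \<in> verts M" "w \<in> verts M" "v \<noteq> w" "C \<subseteq> verts M - {v, w}"
  shows "m_separated M {v} {w} C \<longleftrightarrow> m_separated_vertices M v w C"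
  using assms by (auto simp: m_separated_def)

lemma markov_equivalent_vertices:
  assumes "markov_equivalent M N" "v \<in> verts M" "w \<in> verts M" "v \<noteq> w" "C \<subseteq> verts M - {v, w}"
  shows "m_separated_vertices M v w C \<longleftrightarrow> m_separated_vertices N v w C"
  using assms m_separated_singleton[of v M w C] m_separated_singleton[of v N w C]
  by (auto simp: markov_equivalent_def)

section \<open>Arrowheads determine the edge types and count the edges\<close>

lemma simple_mixed_graph_eqI:
  assumes M: "simple_mixed_graph M" and N: "simple_mixed_graph N"
    and V: "verts M = verts N"
    and adj: "\<And>v w. adjacent M v w \<longleftrightarrow> adjacent N v w"
    and into: "\<And>v w. into M v w \<longleftrightarrow> into N v w"
  shows "M = N"
proof -
  \<comment> \<open>In a simple graph the type of an edge can be read off from the arrowheads at its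
    two ends.\<close>
  have dir: "(v, w) \<in> dir X \<longleftrightarrow> into X v w \<and> \<not> into X w v"
    and bid: "{v, w} \<in> bid X \<longleftrightarrow> into X v w \<and> into X w v"
    and und: "{v, w} \<in> und X \<longleftrightarrow> adjacent X v w \<and> \<not> into X v w \<and> \<not> into X w v"
    if X: "simple_mixed_graph X" for X :: "'a mixed_graph" and v w
  proof -
    have "(v, w) \<in> dir X \<Longrightarrow> (w, v) \<notin> dir X \<and> {v, w} \<notin> und X \<and> {v, w} \<notin> bid X"
      "(w, v) \<in> dir X \<Longrightarrow> {w, v} \<notin> und X \<and> {w, v} \<notin> bid X"
      "{v, w} \<in> und X \<Longrightarrow> {v, w} \<notin> bid X"
      using X unfolding simple_mixed_graph_def by (simp_all add: disjoint_iff)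
    then show "(v, w) \<in> dir X \<longleftrightarrow> into X v w \<and> \<not> into X w v"
      "{v, w} \<in> bid X \<longleftrightarrow> into X v w \<and> into X w v"
      "{v, w} \<in> und X \<longleftrightarrow> adjacent X v w \<and> \<not> into X v w \<and> \<not> into X w v"
      unfolding into_def adjacent_def insert_commute[of w v] by blast+
  qed
  \<comment> \<open>Testing membership of doubletons only decides equality for sets that consist of
    doubletons.\<close>
  have eqI: "A = B" if "A \<subseteq> {{v, w} | v w. v \<in> V \<and> w \<in> V \<and> v \<noteq> w}"
    "B \<subseteq> {{v, w} | v w. v \<in> V \<and> w \<in> V \<and> v \<noteq> w}" "\<And>v w. {v, w} \<in> A \<longleftrightarrow> {v, w} \<in> B"
    for A B and V :: "'a set"
    using that by blast
  have "dir M = dir N"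
    using dir[OF M] dir[OF N] into by auto
  moreover have "bid M = bid N"
    by (rule eqI[of _ "verts M"])
      (use M N V bid[OF M] bid[OF N] into in \<open>auto simp: simple_mixed_graph_def\<close>)
  moreover have "und M = und N"
    by (rule eqI[of _ "verts M"])
      (use M N V und[OF M] und[OF N] into adj in \<open>auto simp: simple_mixed_graph_def\<close>)
  ultimately show ?thesis using V by simp
qed

lemma card_ordered_pairs_of_doubletons:
  assumes "finite B" "\<And>e. e \<in> B \<Longrightarrow> \<exists>v w. e = {v, w} \<and> v \<noteq> w"
  shows "finite {(v, w). {v, w} \<in> B} \<and> card {(v, w). {v, w} \<in> B} = 2 * card B"
  using assms
proof (induction B rule: finite_induct)
  case (insert e B)
  then obtain a b where ab: "e = {a, b}" "a \<noteq> b" by blast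
  have "{(v, w). {v, w} \<in> insert e B} = {(a, b), (b, a)} \<union> {(v, w). {v, w} \<in> B}"
    using ab by (auto simp: doubleton_eq_iff)
  moreover have "{(a, b), (b, a)} \<inter> {(v, w). {v, w} \<in> B} = {}"
    using ab insert.hyps by (auto simp: insert_commute)
  ultimately show ?case
    using ab insert by (simp add: card_Un_disjoint)
qed simp

lemma simple_mixed_graph_finite_edges:
  assumes "simple_mixed_graph M"
  shows "finite (dir M)" "finite (bid M)"
proof -
  have fin: "finite (verts M)" using assms by (simp add: simple_mixed_graph_def)
  have "dir M \<subseteq> verts M \<times> verts M" "bid M \<subseteq> Pow (verts M)"
    using assms unfolding simple_mixed_graph_def by auto
  then show "finite (dir M)" "finite (bid M)"
    using fin by (meson finite_Pow_iff finite_SigmaI finite_subset)+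
qed

text \<open>Each arrowhead is one ordered pair, so a bi-directed edge contributes two. Arrowhead
  counts can then be compared through inclusion of sets.\<close>

lemma num_arrowheads_eq_card_into:
  assumes "simple_mixed_graph M"
  shows "finite {(v, w). into M v w}" "num_arrowheads M = card {(v, w). into M v w}"
proof -
  have eq: "{(v, w). into M v w} = dir M \<union> {(v, w). {v, w} \<in> bid M}"
    by (auto simp: into_def)
  have "dir M \<inter> {(v, w). {v, w} \<in> bid M} = {}"
    using assms unfolding simple_mixed_graph_def by blast
  moreover have "finite {(v, w). {v, w} \<in> bid M} \<and> card {(v, w). {v, w} \<in> bid M} = 2 * card (bid M)"
    using simple_mixed_graph_finite_edges[OF assms] assms
    by (intro card_ordered_pairs_of_doubletons) (auto simp: simple_mixed_graph_def dest!: subsetD)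
  ultimately show "finite {(v, w). into M v w}" "num_arrowheads M = card {(v, w). into M v w}"
    using simple_mixed_graph_finite_edges[OF assms]
    unfolding eq num_arrowheads_def by (auto simp: card_Un_disjoint)
qed

section \<open>Linear extensions of acyclic relations\<close>

lemma acyclic_linear_extension:
  assumes "finite V" "acyclic R"
  obtains r where "linear_order_on V r" "R \<inter> V \<times> V \<subseteq> r"
proof -
  let ?R = "R \<inter> V \<times> V"
  \<comment> \<open>Rank by the number of strict predecessors, with ties broken by an injection
    \<open>g\<close> into the naturals. The rank grows along \<open>(v, w)\<close>, as
    \<open>v\<close> precedes \<open>w\<close> but, by acyclicity, not itself.\<close>
  define f where "f v = card {u \<in> V. (u, v) \<in> ?R\<^sup>+}" for v
  obtain g :: "'a \<Rightarrow> nat" where g: "inj_on g V"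
    using finite_imp_inj_to_nat_seg[OF assms(1)] by blast
  let ?r = "{(v, w). v \<in> V \<and> w \<in> V \<and> (f v < f w \<or> f v = f w \<and> g v \<le> g w)}"
  have acyc: "acyclic ?R" using assms(2) by (rule acyclic_subset) auto
  have "f v < f w" if "(v, w) \<in> ?R" for v w
  proof -
    have "{u \<in> V. (u, v) \<in> ?R\<^sup>+} \<subset> {u \<in> V. (u, w) \<in> ?R\<^sup>+}"
      using that acyc by (auto simp: acyclic_def intro: trancl_into_trancl)
    then show ?thesis unfolding f_def using assms(1) by (simp add: psubset_card_mono)
  qed
  then have "?R \<subseteq> ?r" by auto
  moreover have "linear_order_on V ?r"
    unfolding order_on_defs refl_on_def antisym_def trans_def total_on_def
    using g by (auto simp: inj_on_def)
  ultimately show ?thesis using that by blast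
qed

section \<open>Bi-directed graphs\<close>

text \<open>On an induced path all consecutive triples are unshielded, hence colliders. The graph
  \<open>M\<close> is kept general so that the lemma serves both \<open>G\<close> itself and the
  constructed graph.\<close>

lemma connected_within_imp_m_connecting:
  assumes adj: "\<And>x y. adjacent M x y \<longleftrightarrow> adjacent G x y"
    and coll: "\<And>a x b. \<lbrakk>adjacent G a x; adjacent G x b; a \<noteq> b; \<not> adjacent G a b\<rbrakk> \<Longrightarrow> collider M a x b"
    and U: "insert v (insert w C) \<subseteq> verts M"
    and conn: "connected_within (adjacent G) (insert v (insert w C)) v w"
  shows "\<exists>p. m_connecting M C v p w"
proof -
  obtain p where p: "walk (adjacent G) v p w" "set p \<subseteq> insert v (insert w C)" "distinct p"
    "triplewise (\<lambda>a x b. \<not> adjacent G a b) p"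
    using connected_within_imp_induced_path[OF conn] by blast
  have "collider M (p ! i) (p ! Suc i) (p ! Suc (Suc i)) \<and> p ! Suc i \<in> An M C"
    if i: "Suc (Suc i) < length p" for i
  proof
    have "adjacent G (p ! i) (p ! Suc i)" "adjacent G (p ! Suc i) (p ! Suc (Suc i))"
      using p(1) i by (auto simp: walk_def successively_conv_nth)
    moreover have "p ! i \<noteq> p ! Suc (Suc i)"
      using p(3) i by (simp add: nth_eq_iff_index_eq)
    moreover have "\<not> adjacent G (p ! i) (p ! Suc (Suc i))"
      using p(4) i by (simp add: triplewise_iff_nth)
    ultimately show "collider M (p ! i) (p ! Suc i) (p ! Suc (Suc i))" by (rule coll)
    \<comment> \<open>By distinctness an inner vertex is neither endpoint, which leaves only
      \<open>C\<close>.\<close>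
    have "p ! Suc i \<noteq> p ! 0" "p ! Suc i \<noteq> p ! (length p - 1)"
      using i nth_eq_iff_index_eq[OF p(3), of "Suc i" 0]
        nth_eq_iff_index_eq[OF p(3), of "Suc i" "length p - 1"]
      by linarith+
    moreover have "p ! 0 = v" "p ! (length p - 1) = w"
      using p(1) by (auto simp: walk_def hd_conv_nth last_conv_nth)
    moreover have "p ! Suc i \<in> set p" using i by simp
    ultimately have "p ! Suc i \<in> C" using p(2) by blast
    then show "p ! Suc i \<in> An M C" by (auto simp: An_def ancestor_def)
  qed
  then have "m_connecting M C v p w"
    using p U adj unfolding m_connecting_iff_triplewise triplewise_iff_nth
    by (auto simp: walk_def successively_conv_nth)
  then show ?thesis ..
qed

text \<open>The idea is to replace every inner vertex by a vertex of \<open>C\<close> with a larger boundary.\<close>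

lemma successively_imp_connected_within:
  assumes "successively (\<lambda>x y. y \<in> Bd G x) (a # xs)"
    and "triplewise (\<lambda>_ x _. \<exists>c \<in> C. Bd G x \<subseteq> Bd G c) (a # xs)"
    and "last (a # xs) = w" "Bd G a \<subseteq> Bd G c" "c \<in> U" "w \<in> U" "C \<subseteq> U"
  shows "connected_within (adjacent G) U c w"
  using assms
proof (induction xs arbitrary: a c)
  case Nil
  then have "w \<in> Bd G c" by (auto simp: Bd_def)
  then show ?case using Nil by (auto simp: Bd_def)
next
  case (Cons b xs)
  \<comment> \<open>If \<open>b\<close> ends the walk, take \<open>w\<close> itself; otherwise
    \<open>b\<close> is an inner vertex and is dominated by an element of \<open>C\<close>.\<close>
  have "\<exists>c' \<in> U. Bd G b \<subseteq> Bd G c'"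
    using Cons.prems by (cases xs) auto
  then obtain c' where c': "c' \<in> U" "Bd G b \<subseteq> Bd G c'" by blast
  have "c \<in> Bd G b" using Cons.prems by (auto simp: successively_Cons mem_Bd_commute)
  then have "c = c' \<or> adjacent G c c'" using c'(2) by (auto simp: Bd_def adjacent_commute)
  then have "connected_within (adjacent G) U c c'" using Cons.prems c'(1) by auto
  moreover have "connected_within (adjacent G) U c' w"
  proof (rule Cons.IH[of b])
    show "successively (\<lambda>x y. y \<in> Bd G x) (b # xs)"
      using Cons.prems(1) by (simp add: successively_Cons)
    show "triplewise (\<lambda>_ x _. \<exists>c \<in> C. Bd G x \<subseteq> Bd G c) (b # xs)"
      using Cons.prems(2) by (cases xs) simp_all
  qed (use Cons.prems c' in simp_all)
  ultimately show ?case by (rule rtrancl_trans)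
qed

lemma walk_imp_connected_within:
  assumes "walk (\<lambda>x y. y \<in> Bd G x) v p w"
    and "triplewise (\<lambda>_ x _. \<exists>c \<in> C. Bd G x \<subseteq> Bd G c) p"
  shows "connected_within (adjacent G) (insert v (insert w C)) v w"
proof -
  obtain xs where p: "p = v # xs" "last (v # xs) = w" "successively (\<lambda>x y. y \<in> Bd G x) (v # xs)"
    using assms(1) unfolding walk_def by (metis list.collapse)
  show ?thesis
    by (rule successively_imp_connected_within[OF p(3) _ p(2)]) (use assms(2) p(1) in auto)
qed

text \<open>The boundary of a simplicial vertex is a clique, so each member is adjacent to all
  others.\<close>

lemma Bd_subset_of_simplicial: "simplicial G v \<Longrightarrow> w \<in> Bd G v \<Longrightarrow> Bd G v \<subseteq> Bd G w"
  unfolding simplicial_def Bd_def[of G w] by (intro subsetI) fastforce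

lemma simplicial_antimono: "simplicial G w \<Longrightarrow> v \<in> verts G \<Longrightarrow> Bd G v \<subseteq> Bd G w \<Longrightarrow> simplicial G v"
  unfolding simplicial_def by blast

locale bidirected =
  fixes G :: "'a mixed_graph"
  assumes bidirected: "bidirected_graph G"
begin

lemma simple: "simple_mixed_graph G"
  using bidirected by (simp add: bidirected_graph_def)

lemma adjacent_iff: "adjacent G v w \<longleftrightarrow> {v, w} \<in> bid G"
  using bidirected by (simp add: bidirected_graph_def adjacent_def)

lemma no_tails: "und G = {}" "dir G = {}"
  using bidirected by (simp_all add: bidirected_graph_def)

lemma into_iff: "into G v w \<longleftrightarrow> adjacent G v w"
  by (simp add: into_def adjacent_iff no_tails)

lemma m_connecting_iff_connected_within:
  assumes "insert v (insert w C) \<subseteq> verts G"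
  shows "(\<exists>p. m_connecting G C v p w) \<longleftrightarrow>
    connected_within (adjacent G) (insert v (insert w C)) v w"
proof
  assume "\<exists>p. m_connecting G C v p w"
  then obtain p where p: "m_connecting G C v p w" ..
  then have walk: "walk (adjacent G) v p w"
    by (simp add: m_connecting_iff_triplewise)
  \<comment> \<open>Without tails every inner vertex is a collider, and without directed edges
    \<open>An G C\<close> is just \<open>C\<close>.\<close>
  have "p ! Suc i \<in> C" if "Suc (Suc i) < length p" for i
    using p walk that unfolding m_connecting_def walk_def successively_conv_nth
    by (auto simp: collider_def into_iff An_def ancestor_def no_tails adjacent_commute)
  then have "triplewise (\<lambda>_ x _. \<exists>c \<in> C. Bd G x \<subseteq> Bd G c) p"
    by (auto simp: triplewise_iff_nth)
  moreover have "walk (\<lambda>x y. y \<in> Bd G x) v p w"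
    using walk by (auto simp: walk_def Bd_def elim: successively_mono)
  ultimately show "connected_within (adjacent G) (insert v (insert w C)) v w"
    by (intro walk_imp_connected_within)
next
  assume "connected_within (adjacent G) (insert v (insert w C)) v w"
  then show "\<exists>p. m_connecting G C v p w"
    using assms by (intro connected_within_imp_m_connecting[of G G])
      (auto simp: collider_def into_iff adjacent_commute)
qed

section \<open>Maximal ancestral graphs Markov equivalent to a bi-directed graph\<close>

lemma m_separated_empty:
  assumes "v \<in> verts G" "w \<in> verts G" "v \<noteq> w" "\<not> adjacent G v w"
  shows "m_separated_vertices G v w {}"
proof -
  have "\<not> connected_within (adjacent G) {v, w} v w"
  proof
    assume "connected_within (adjacent G) {v, w} v w"
    then obtain y where "adjacent G v y" "y \<in> {v, w}"
      using assms(3) by (auto elim: converse_rtranclE)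
    then show False using assms(4) adjacent_verts[OF simple] by blast
  qed
  then show ?thesis
    using m_connecting_iff_connected_within[of v w "{}"] assms by (simp add: m_separated_vertices_def)
qed

text \<open>An edge m-connects its ends given any set. An extra edge of \<open>H\<close> would
  violate separation by the empty set; for an edge missing in \<open>H\<close>, maximality supplies
  a separating set that the edge of \<open>G\<close> violates.\<close>

lemma adjacent_markov_equivalent:
  assumes H: "maximal_ancestral H" and eq: "markov_equivalent G H"
  shows "adjacent H v w \<longleftrightarrow> adjacent G v w"
proof
  have H': "simple_mixed_graph H" using H by (simp add: maximal_ancestral_def ancestral_def)
  have V: "verts H = verts G" using eq by (simp add: markov_equivalent_def)
  show "adjacent G v w" if adj: "adjacent H v w"
  proof (rule ccontr)
    assume "\<not> adjacent G v w"
    with adj adjacent_verts[OF H' adj] V have "m_separated_vertices H v w {}"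
      using m_separated_empty markov_equivalent_vertices[OF eq, of v w "{}"] by auto
    then show False using m_connecting_edge[OF H' adj] by (auto simp: m_separated_vertices_def)
  qed
  show "adjacent H v w" if adj: "adjacent G v w"
  proof (rule ccontr)
    note vw = adjacent_verts[OF simple adj]
    assume "\<not> adjacent H v w"
    with H vw V obtain C where C: "C \<subseteq> verts G - {v, w}" "m_separated_vertices H v w C"
      by (metis maximal_ancestral_def)
    then have "m_separated_vertices G v w C"
      using vw markov_equivalent_vertices[OF eq] by blast
    then show False using m_connecting_edge[OF simple adj] by (auto simp: m_separated_vertices_def)
  qed
qed

text \<open>Otherwise \<open>a, x, b\<close> would m-connect given the empty set, which separates
  \<open>a\<close> and \<open>b\<close> in \<open>G\<close> and hence in \<open>H\<close>.\<close>

lemma unshielded_collider: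
  assumes H: "maximal_ancestral H" and eq: "markov_equivalent G H"
    and adj: "adjacent G a x" "adjacent G x b" and "a \<noteq> b" "\<not> adjacent G a b"
  shows "collider H a x b"
proof (rule ccontr)
  assume "\<not> collider H a x b"
  moreover have "simple_mixed_graph H" using H by (simp add: maximal_ancestral_def ancestral_def)
  ultimately have "m_connecting H {} a [a, x, b] b"
    using adj \<open>a \<noteq> b\<close> by (intro m_connecting_noncollider) (auto simp: adjacent_markov_equivalent[OF H eq])
  moreover have "m_separated_vertices H a b {}"
    using assms m_separated_empty[of a b] markov_equivalent_vertices[OF eq, of a b "{}"]
      adjacent_verts[OF simple adj(1)] adjacent_verts[OF simple adj(2)] by auto
  ultimately show False by (auto simp: m_separated_vertices_def)
qed

text \<open>A neighbour \<open>u\<close> of \<open>v\<close> outside \<open>Bd G w\<close> would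
  make \<open>u, v, w\<close> unshielded and force an arrowhead at \<open>v\<close>.\<close>

lemma tail_imp_Bd_subset:
  assumes H: "maximal_ancestral H" and eq: "markov_equivalent G H"
    and adj: "adjacent G v w" and tail: "\<not> into H w v"
  shows "Bd G v \<subseteq> Bd G w"
proof
  fix u assume u: "u \<in> Bd G v"
  show "u \<in> Bd G w"
  proof (rule ccontr)
    assume "u \<notin> Bd G w"
    with u adj have "adjacent G u v" "u \<noteq> w" "\<not> adjacent G u w"
      by (auto simp: Bd_def adjacent_commute)
    then have "collider H u v w" using unshielded_collider[OF H eq _ adj] by blast
    with tail show False by (simp add: collider_def)
  qed
qed

text \<open>An undirected edge at \<open>v\<close> excludes all arrowheads at \<open>v\<close>.
  Every edge at \<open>v\<close> then has a tail there, so each neighbour's boundary contains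
  \<open>Bd G v\<close>, which is therefore a clique.\<close>

lemma und_imp_simplicial:
  assumes H: "maximal_ancestral H" and eq: "markov_equivalent G H"
    and und: "{v, w} \<in> und H"
  shows "simplicial G v"
proof -
  note adj = adjacent_markov_equivalent[OF H eq]
  have anc: "ancestral H" using H by (simp add: maximal_ancestral_def)
  have no_arrow: "\<not> into H u v" for u
    using anc und unfolding ancestral_def into_def by blast
  have "adjacent G v w" using und unfolding adj[symmetric] by (simp add: adjacent_def)
  then have "v \<in> verts G" using adjacent_verts[OF simple] by blast
  moreover have "Bd G v \<subseteq> Bd G u" if "u \<in> Bd G v" for u
    using that tail_imp_Bd_subset[OF H eq _ no_arrow] by (auto simp: Bd_def)
  ultimately show ?thesis unfolding simplicial_def by (fastforce simp: Bd_def)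
qed

section \<open>The constructed graph\<close>

context
  fixes r :: "'a rel"
  assumes r: "total_extension G r"
begin

lemma order_antisym: "(v, w) \<in> r \<Longrightarrow> (w, v) \<in> r \<Longrightarrow> v = w"
  using r by (auto simp: total_extension_def order_on_defs dest: antisymD)

lemma order_transitive: "(u, v) \<in> r \<Longrightarrow> (v, w) \<in> r \<Longrightarrow> (u, w) \<in> r"
  using r by (auto simp: total_extension_def order_on_defs dest: transD)

lemma order_total: "v \<in> verts G \<Longrightarrow> w \<in> verts G \<Longrightarrow> v \<noteq> w \<Longrightarrow> (v, w) \<in> r \<or> (w, v) \<in> r"
  using r by (auto simp: total_extension_def order_on_defs total_on_def)

lemma order_Bd: "v \<in> verts G \<Longrightarrow> w \<in> verts G \<Longrightarrow> Bd G v \<subset> Bd G w \<Longrightarrow> (v, w) \<in> r"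
  using r by (auto simp: total_extension_iff)

lemma bid_simplicial_graph_iff:
  "{v, w} \<in> bid (simplicial_graph G) \<longleftrightarrow> adjacent G v w \<and> \<not> simplicial G v \<and> \<not> simplicial G w"
  by (auto simp: simplicial_graph_def drop_arrowheads_def adjacent_iff doubleton_eq_iff insert_commute)

lemma verts_Gmin: "verts (Gmin G r) = verts G"
  by (simp add: Gmin_def Let_def simplicial_graph_def drop_arrowheads_def)

lemma und_Gmin_iff:
  "{v, w} \<in> und (Gmin G r) \<longleftrightarrow> adjacent G v w \<and> simplicial G v \<and> simplicial G w"
  by (auto simp: Gmin_def Let_def simplicial_graph_def drop_arrowheads_def adjacent_iff no_tails
      doubleton_eq_iff insert_commute)

text \<open>A single condition covers both kinds of directed edges, since the boundary of a simplicial vertex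
  is strictly contained in that of a non-simplicial neighbour.\<close>

lemma dir_Gmin_iff:
  "(v, w) \<in> dir (Gmin G r) \<longleftrightarrow>
     adjacent G v w \<and> \<not> simplicial G w \<and> Bd G v \<subseteq> Bd G w \<and> (v, w) \<in> r"
proof -
  have "(v, w) \<in> dir (Gmin G r) \<longleftrightarrow>
      adjacent G v w \<and> simplicial G v \<and> \<not> simplicial G w \<or> (v, w) \<in> newly_directed G r"
    by (auto simp: Gmin_def Let_def simplicial_graph_def drop_arrowheads_def adjacent_iff no_tails)
  moreover have "Bd G v \<subset> Bd G w"
    if "adjacent G v w" "simplicial G v" "\<not> simplicial G w"
    using that Bd_subset_of_simplicial[of G v w] simplicial_antimono[of G v w]
      adjacent_verts[OF simple that(1)] by (auto simp: Bd_def)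
  ultimately show ?thesis
    using order_Bd[of v w] adjacent_verts[OF simple, of v w]
    by (auto simp: newly_directed_def bid_simplicial_graph_iff)
qed

text \<open>Comparable boundaries always lead to a tail: strict inclusion is respected by
  \<open>r\<close>, and equal boundaries are ordered by totality. Simpliciality drops out because a
  simplicial end has its boundary contained in the other.\<close>

lemma bid_Gmin_iff:
  "{v, w} \<in> bid (Gmin G r) \<longleftrightarrow>
     adjacent G v w \<and> \<not> Bd G v \<subseteq> Bd G w \<and> \<not> Bd G w \<subseteq> Bd G v"
proof (cases "adjacent G v w")
  case True
  note vw = adjacent_verts[OF simple True]
  have "{v, w} \<in> bid (Gmin G r) \<longleftrightarrow> {v, w} \<in> bid (simplicial_graph G) \<and>
      (v, w) \<notin> newly_directed G r \<and> (w, v) \<notin> newly_directed G r"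
    by (auto simp: Gmin_def Let_def doubleton_eq_iff)
  also have "\<dots> \<longleftrightarrow> \<not> simplicial G v \<and> \<not> simplicial G w \<and>
      \<not> (Bd G v \<subseteq> Bd G w \<and> (v, w) \<in> r) \<and> \<not> (Bd G w \<subseteq> Bd G v \<and> (w, v) \<in> r)"
    using True vw by (auto simp: newly_directed_def bid_simplicial_graph_iff insert_commute adjacent_commute)
  also have "\<dots> \<longleftrightarrow> \<not> simplicial G v \<and> \<not> simplicial G w \<and> \<not> Bd G v \<subseteq> Bd G w \<and> \<not> Bd G w \<subseteq> Bd G v"
    using order_total[of v w] order_Bd[of v w] order_Bd[of w v] vw by blast
  also have "\<dots> \<longleftrightarrow> \<not> Bd G v \<subseteq> Bd G w \<and> \<not> Bd G w \<subseteq> Bd G v"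
    using Bd_subset_of_simplicial[of G v w] Bd_subset_of_simplicial[of G w v] True
    by (auto simp: Bd_def adjacent_commute)
  finally show ?thesis using True by simp
next
  case False
  then show ?thesis by (simp add: Gmin_def Let_def bid_simplicial_graph_iff)
qed

lemma adjacent_Gmin_iff: "adjacent (Gmin G r) v w \<longleftrightarrow> adjacent G v w"
proof
  assume "adjacent (Gmin G r) v w"
  then show "adjacent G v w"
    by (auto simp: adjacent_def[of "Gmin G r"] und_Gmin_iff dir_Gmin_iff bid_Gmin_iff adjacent_commute)
next
  assume adj: "adjacent G v w"
  note vw = adjacent_verts[OF simple adj]
  have adj': "adjacent G w v" "w \<in> Bd G v" "v \<in> Bd G w"
    using adj by (auto simp: Bd_def adjacent_commute)
  show "adjacent (Gmin G r) v w"
    unfolding adjacent_def[of "Gmin G r"] und_Gmin_iff dir_Gmin_iff bid_Gmin_iff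
    using adj adj' vw order_total[of v w] order_Bd[of v w] order_Bd[of w v]
      simplicial_antimono[of G v w] simplicial_antimono[of G w v]
      Bd_subset_of_simplicial[of G v w] Bd_subset_of_simplicial[of G w v]
    by blast
qed

text \<open>A tail lies on an undirected edge, whose ends are simplicial, or on a directed edge out
  of \<open>v\<close>. Either way \<open>Bd G v\<close> is contained in
  \<open>Bd G w\<close>.\<close>

lemma tail_Gmin:
  assumes "adjacent G v w" "\<not> into (Gmin G r) w v"
  shows "simplicial G v \<or> (Bd G v \<subseteq> Bd G w \<and> (v, w) \<in> r)"
proof -
  have "adjacent (Gmin G r) v w" using assms adjacent_Gmin_iff by simp
  then show ?thesis
    using assms(2)
    unfolding adjacent_def[of "Gmin G r"] into_def und_Gmin_iff dir_Gmin_iff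
    by (auto simp: insert_commute)
qed

section \<open>The constructed graph is ancestral\<close>

lemma simple_Gmin: "simple_mixed_graph (Gmin G r)"
proof -
  have fin: "finite (verts G)" using simple by (simp add: simple_mixed_graph_def)
  \<comment> \<open>The edge characterisations only speak of sets written \<open>{v, w}\<close>, so
    edges are first brought into this form.\<close>
  have und: "\<exists>v w. e = {v, w}" if "e \<in> und (Gmin G r)" for e
    using that by (auto simp: Gmin_def Let_def simplicial_graph_def drop_arrowheads_def no_tails)
  have bid: "\<exists>v w. e = {v, w}" if "e \<in> bid (Gmin G r)" for e
    using that by (auto simp: Gmin_def Let_def simplicial_graph_def drop_arrowheads_def)
  have edge: "{v, w} \<in> {{v, w} | v w. v \<in> verts G \<and> w \<in> verts G \<and> v \<noteq> w}" if "adjacent G v w" for v w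
    using adjacent_verts[OF simple that] by blast
  have "und (Gmin G r) \<subseteq> {{v, w} | v w. v \<in> verts G \<and> w \<in> verts G \<and> v \<noteq> w}"
    using und edge und_Gmin_iff by (metis (lifting) subsetI)
  moreover have "bid (Gmin G r) \<subseteq> {{v, w} | v w. v \<in> verts G \<and> w \<in> verts G \<and> v \<noteq> w}"
    using bid edge bid_Gmin_iff by (metis (lifting) subsetI)
  moreover have "dir (Gmin G r) \<subseteq> {(v, w) | v w. v \<in> verts G \<and> w \<in> verts G \<and> v \<noteq> w}"
    by (auto simp: dir_Gmin_iff dest: adjacent_verts[OF simple])
  moreover have "und (Gmin G r) \<inter> bid (Gmin G r) = {}"
  proof -
    have False if "{v, w} \<in> und (Gmin G r)" "{v, w} \<in> bid (Gmin G r)" for v w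
      using that Bd_subset_of_simplicial[of G v w] by (auto simp: und_Gmin_iff bid_Gmin_iff Bd_def)
    then show ?thesis using und by blast
  qed
  moreover have "(w, v) \<notin> dir (Gmin G r) \<and> {v, w} \<notin> und (Gmin G r) \<and> {v, w} \<notin> bid (Gmin G r)"
    if "(v, w) \<in> dir (Gmin G r)" for v w
    using that order_antisym[of v w] adjacent_verts[OF simple, of v w]
    by (auto simp: und_Gmin_iff bid_Gmin_iff dir_Gmin_iff)
  ultimately show ?thesis using fin by (simp add: simple_mixed_graph_def verts_Gmin)
qed

text \<open>Boundaries grow along directed edges. Thus bi-directed edges, whose ends have
  incomparable boundaries, never join ancestors, and a collider in \<open>An (Gmin G r) C\<close> is
  dominated by an element of \<open>C\<close>.\<close>

lemma ancestor_Gmin_imp_Bd_subset: "ancestor (Gmin G r) v w \<Longrightarrow> Bd G v \<subseteq> Bd G w"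
  unfolding ancestor_def by (induction rule: rtrancl_induct) (auto simp: dir_Gmin_iff)

lemma ancestral_Gmin: "ancestral (Gmin G r)"
proof -
  \<comment> \<open>Directed edges go strictly upwards in \<open>r\<close>, which rules out directed
    cycles.\<close>
  have "(v, w) \<in> r - Id" if "(v, w) \<in> (dir (Gmin G r))\<^sup>+" for v w
    using that
  proof (induction rule: trancl_induct)
    case (base y)
    then show ?case using adjacent_verts[OF simple, of v y] by (auto simp: dir_Gmin_iff)
  next
    case (step y z)
    then show ?case
      using adjacent_verts[OF simple, of y z] order_transitive[of v y z] order_antisym[of y z]
      by (auto simp: dir_Gmin_iff)
  qed
  then have "acyclic (dir (Gmin G r))" by (auto simp: acyclic_def)
  moreover have "\<not> (\<exists>u. (u, v) \<in> dir (Gmin G r) \<or> {u, v} \<in> bid (Gmin G r))"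
    if "{v, w} \<in> und (Gmin G r)" for v w
    using that Bd_subset_of_simplicial[of G v]
    by (auto simp: und_Gmin_iff dir_Gmin_iff bid_Gmin_iff Bd_def adjacent_commute)
  moreover have "\<not> ancestor (Gmin G r) v w" if "{v, w} \<in> bid (Gmin G r)" for v w
    using that ancestor_Gmin_imp_Bd_subset[of v w] by (auto simp: bid_Gmin_iff)
  ultimately show ?thesis using simple_Gmin by (simp add: ancestral_def)
qed

section \<open>The constructed graph is maximal and Markov equivalent to \<open>G\<close>\<close>

lemma unshielded_collider_Gmin:
  assumes adj: "adjacent G a x" "adjacent G x b" and "a \<noteq> b" "\<not> adjacent G a b"
  shows "collider (Gmin G r) a x b"
proof -
  \<comment> \<open>A tail at \<open>x\<close> towards \<open>a\<close> would place
    \<open>b\<close>, a member of \<open>Bd G x\<close>, in \<open>Bd G a\<close>, and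
    symmetrically.\<close>
  have sub: "Bd G x \<subseteq> Bd G y" if "adjacent G x y" "\<not> into (Gmin G r) y x" for y
    using tail_Gmin[OF that] Bd_subset_of_simplicial[of G x y] that by (auto simp: Bd_def)
  have "a \<notin> Bd G b" "b \<notin> Bd G a" "a \<in> Bd G x" "b \<in> Bd G x"
    using assms by (auto simp: Bd_def adjacent_commute)
  then show ?thesis using sub[of a] sub[of b] adj by (auto simp: collider_def adjacent_commute)
qed

text \<open>A non-collider can be skipped: the neighbour at the other end of its tail
  inherits its adjacencies, and transitivity of the order keeps the condition \<open>Q\<close> at the
  vertices next to it. Hence a shortest walk only has inner vertices
  that are dominated by elements of \<open>C\<close>.\<close>

lemma m_connecting_Gmin_imp_connected_within:
  assumes conn: "m_connecting (Gmin G r) C v p w"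
  shows "connected_within (adjacent G) (insert v (insert w C)) v w"
proof -
  define D where "D = {x. \<exists>c \<in> C. Bd G x \<subseteq> Bd G c}"
  define L where "L x y \<longleftrightarrow> Bd G x \<subseteq> Bd G y \<and> (x, y) \<in> r \<and> x \<noteq> y" for x y
  \<comment> \<open>\<open>Q\<close> is what a non-collider retains: a tail at \<open>x\<close>
    towards \<open>a\<close> or \<open>b\<close>. Unlike the original condition, it survives
    shortening.\<close>
  define Q where "Q a x b \<longleftrightarrow> simplicial G x \<or> L x a \<or> L x b" for a x b
  let ?R = "\<lambda>x y. y \<in> Bd G x"
  \<comment> \<open>Membership in \<open>Bd\<close> lets a step stay in place, so distinctness need
    not be maintained when vertices are skipped.\<close>
  let ?P = "\<lambda>q. walk ?R v q w \<and> set q \<subseteq> verts G \<and> triplewise (\<lambda>a x b. x \<in> D \<or> Q a x b) q"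
  have "x \<in> D \<or> Q a x b"
    if adj: "adjacent G a x" "adjacent G x b"
      and m: "if collider (Gmin G r) a x b then x \<in> An (Gmin G r) C else x \<notin> C" for a x b
  proof (cases "collider (Gmin G r) a x b")
    case True
    then show ?thesis
      using m ancestor_Gmin_imp_Bd_subset[of x] by (auto simp: An_def D_def)
  next
    case False
    then show ?thesis
      using tail_Gmin[of x a] tail_Gmin[of x b] adj adjacent_verts[OF simple, of x]
      by (auto simp: collider_def Q_def L_def adjacent_commute)
  qed
  then have "?P p"
    using conn unfolding m_connecting_iff_triplewise walk_def triplewise_iff_nth successively_conv_nth
    by (auto simp: adjacent_Gmin_iff Bd_def verts_Gmin)
  then obtain q where q: "?P q" and least: "\<And>q'. ?P q' \<Longrightarrow> length q \<le> length q'"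
    using ex_has_least_nat[of ?P p length] by blast
  have Q_commute: "Q a x b \<longleftrightarrow> Q b x a" for a x b by (auto simp: Q_def)
  \<comment> \<open>Only the case \<open>L a x\<close> needs an argument. If \<open>x\<close> is
    simplicial, so is \<open>a\<close>; \<open>L x a\<close> contradicts antisymmetry;
    \<open>L x b\<close> gives \<open>L a b\<close> by transitivity.\<close>
  have skip: "Q z a b" if "Q z a x" "Q a x b" "a \<in> verts G" for z a x b
    using that order_antisym[of a x] order_antisym[of x b] order_transitive[of a x b] simplicial_antimono[of G x a]
    unfolding Q_def L_def by blast
  have "triplewise (\<lambda>_ x _. x \<in> D) q"
  proof (rule ccontr)
    assume "\<not> triplewise (\<lambda>_ x _. x \<in> D) q"
    then obtain as a x b bs where eq: "q = as @ a # x # b # bs" and "x \<notin> D"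
      by (elim not_triplewiseE) simp
    have tri: "triplewise (\<lambda>a x b. x \<in> D \<or> Q a x b) (as @ [a, x])" "Q a x b"
      "triplewise (\<lambda>a x b. x \<in> D \<or> Q a x b) (x # b # bs)"
      using q \<open>x \<notin> D\<close> unfolding eq by (simp_all add: triplewise_append[of _ as a x "b # bs"])
    have V: "a \<in> verts G" "b \<in> verts G" using q unfolding eq by auto
    have "?R a x" "?R x b"
      using q unfolding eq by (auto simp: walk_def successively_append_iff successively_Cons)
    then have "?R a b"
      using \<open>Q a x b\<close> Bd_subset_of_simplicial[of G x a] mem_Bd_commute[of _ G]
      unfolding Q_def L_def by (metis subsetD)
    then have "walk ?R v (as @ a # b # bs) w"
      using q walk_shortcut[of ?R v as a "[x]" b bs w] unfolding eq by auto
    \<comment> \<open>Deleting \<open>x\<close> changes only the windows centred at \<open>a\<close>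
      and at \<open>b\<close>. The first is repaired by \<open>skip\<close>, the second by its
      mirror image; a missing outer neighbour means an endpoint and no window.\<close>
    moreover have "triplewise (\<lambda>a x b. x \<in> D \<or> Q a x b) (as @ [a, b])"
    proof (cases as rule: rev_cases)
      case (snoc as' z)
      then show ?thesis
        using tri(1) skip[OF _ \<open>Q a x b\<close> V(1)]
          by (auto simp: triplewise_append[of _ as' z a "[x]"] triplewise_append[of _ as' z a "[b]"])
    qed simp
    moreover have "triplewise (\<lambda>a x b. x \<in> D \<or> Q a x b) (a # b # bs)"
    proof (cases bs)
      case (Cons z bs')
      then show ?thesis
        using tri(3) skip[of z b x a] \<open>Q a x b\<close> V(2) by (auto simp: Q_commute)
    qed simp
    ultimately have "?P (as @ a # b # bs)"
      using q unfolding eq by (auto simp: triplewise_append[of _ as a b bs])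
    from least[OF this] show False by (simp add: eq)
  qed
  then show ?thesis
    using q by (intro walk_imp_connected_within[of G v q w]) (simp_all add: D_def)
qed

text \<open>In both graphs, m-connection given \<open>C\<close> amounts to connectedness in
  \<open>G\<close> within \<open>C\<close> and the two endpoints.\<close>

lemma markov_equivalent_Gmin: "markov_equivalent G (Gmin G r)"
proof -
  have "m_separated_vertices G v w C \<longleftrightarrow> m_separated_vertices (Gmin G r) v w C"
    if "insert v (insert w C) \<subseteq> verts G" for v w C
    using that m_connecting_iff_connected_within[OF that]
      m_connecting_Gmin_imp_connected_within[of C v _ w]
      connected_within_imp_m_connecting[of "Gmin G r" G v w C]
      adjacent_Gmin_iff unshielded_collider_Gmin
    by (auto simp: m_separated_vertices_def verts_Gmin)
  then have "m_separated_vertices G v w C \<longleftrightarrow> m_separated_vertices (Gmin G r) v w C"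
    if "A \<subseteq> verts G" "B \<subseteq> verts G" "C \<subseteq> verts G - (A \<union> B)" "v \<in> A" "w \<in> B" for A B C v w
    using that by blast
  then have "m_separated G A B C \<longleftrightarrow> m_separated (Gmin G r) A B C" for A B C
    unfolding m_separated_def verts_Gmin by (intro conj_cong ball_cong refl)
  then show ?thesis by (simp add: markov_equivalent_def verts_Gmin)
qed

lemma maximal_ancestral_Gmin: "maximal_ancestral (Gmin G r)"
proof -
  have "m_separated_vertices (Gmin G r) v w {}"
    if "v \<in> verts G" "w \<in> verts G" "v \<noteq> w" "\<not> adjacent G v w" for v w
    using that m_separated_empty markov_equivalent_vertices[OF markov_equivalent_Gmin, of v w "{}"]
    by auto
  then show ?thesis
    using ancestral_Gmin by (auto simp: maximal_ancestral_def verts_Gmin adjacent_Gmin_iff)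
qed

section \<open>Comparison with a minimally oriented graph\<close>

lemma into_Gmin_imp_into:
  assumes H: "maximal_ancestral H" and eq: "markov_equivalent G H"
    and "dir H \<subseteq> r" and into: "into (Gmin G r) u v"
  shows "into H u v"
proof (rule ccontr)
  note adj = adjacent_markov_equivalent[OF H eq]
  assume tail: "\<not> into H u v"
  have uv: "adjacent G u v"
    using into by (auto simp: into_def dir_Gmin_iff bid_Gmin_iff)
  \<comment> \<open>The tail in \<open>H\<close> makes the boundaries comparable, so the constructed
    graph has \<open>u \<rightarrow> v\<close> with \<open>(u, v) \<in> r\<close> and
    \<open>v\<close> not simplicial. In \<open>H\<close> the edge is then neither
    \<open>v \<rightarrow> u\<close>, by \<open>dir H \<subseteq> r\<close>, nor undirected.\<close>
  then have "Bd G v \<subseteq> Bd G u"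
    using tail tail_imp_Bd_subset[OF H eq] by (simp add: adjacent_commute)
  then have dir: "(u, v) \<in> dir (Gmin G r)"
    using into by (auto simp: into_def bid_Gmin_iff)
  have "(v, u) \<in> dir H \<or> {v, u} \<in> und H"
    using uv tail unfolding adj[symmetric] by (auto simp: adjacent_def into_def insert_commute)
  then show False
  proof
    assume "(v, u) \<in> dir H"
    then show False
      using dir assms(3) order_antisym[of u v] adjacent_verts[OF simple uv] by (auto simp: dir_Gmin_iff)
  next
    assume "{v, u} \<in> und H"
    then show False using und_imp_simplicial[OF H eq] dir by (auto simp: dir_Gmin_iff)
  qed
qed

lemma minimally_oriented_eq_Gmin:
  assumes min: "minimally_oriented G H" and "dir H \<subseteq> r"
  shows "H = Gmin G r"
proof -
  have H: "maximal_ancestral H" and eq: "markov_equivalent G H"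
    and le: "num_arrowheads H \<le> num_arrowheads (Gmin G r)"
    using min maximal_ancestral_Gmin markov_equivalent_Gmin by (auto simp: minimally_oriented_def)
  have simple_H: "simple_mixed_graph H" using H by (simp add: maximal_ancestral_def ancestral_def)
  have "{(u, v). into (Gmin G r) u v} \<subseteq> {(u, v). into H u v}"
    using into_Gmin_imp_into[OF H eq assms(2)] by auto
  \<comment> \<open>Minimality bounds the larger of two nested finite sets by the smaller, so they
    coincide.\<close>
  moreover have "card {(u, v). into H u v} \<le> card {(u, v). into (Gmin G r) u v}"
    using le num_arrowheads_eq_card_into[OF simple_H] num_arrowheads_eq_card_into[OF simple_Gmin] by simp
  ultimately have "{(u, v). into (Gmin G r) u v} = {(u, v). into H u v}"
    using num_arrowheads_eq_card_into(1)[OF simple_H] by (simp add: card_seteq)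
  then have "into H u v \<longleftrightarrow> into (Gmin G r) u v" for u v by blast
  then show ?thesis
    using simple_H simple_Gmin eq
    by (intro simple_mixed_graph_eqI)
      (auto simp: adjacent_markov_equivalent[OF H eq] adjacent_Gmin_iff verts_Gmin markov_equivalent_def)
qed

end

text \<open>Boundaries grow weakly along directed edges of \<open>H\<close>, so a cycle mixing these
  with strict inclusions contains no strict inclusion and would be a directed cycle of
  \<open>H\<close>.\<close>

lemma exists_total_extension:
  assumes H: "maximal_ancestral H" and eq: "markov_equivalent G H"
  shows "\<exists>r. total_extension G r \<and> dir H \<subseteq> r"
proof -
  have anc: "ancestral H" using H by (simp add: maximal_ancestral_def)
  then have simple_H: "simple_mixed_graph H" by (simp add: ancestral_def)
  have V: "verts H = verts G" using eq by (simp add: markov_equivalent_def)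
  let ?R = "dir H \<union> {(v, w). Bd G v \<subset> Bd G w}"
  have dir: "Bd G v \<subseteq> Bd G w" if "(v, w) \<in> dir H" for v w
  proof -
    have "adjacent G v w"
      using that unfolding adjacent_markov_equivalent[OF H eq, symmetric] by (simp add: adjacent_def)
    moreover have "\<not> into H w v"
      using that simple_H unfolding simple_mixed_graph_def into_def by (auto simp: insert_commute)
    ultimately show ?thesis by (rule tail_imp_Bd_subset[OF H eq])
  qed
  have "Bd G v \<subset> Bd G w \<or> Bd G v = Bd G w \<and> (v, w) \<in> (dir H)\<^sup>+" if "(v, w) \<in> ?R\<^sup>+" for v w
    using that
  proof (induction rule: trancl_induct)
    case (base y)
    then show ?case using dir[of v y] by auto
  next
    case (step y z)
    then show ?case using dir[of y z] by (auto intro: trancl_into_trancl)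
  qed
  then have "acyclic ?R" using anc by (auto simp: acyclic_def ancestral_def)
  moreover have "finite (verts G)" using simple by (simp add: simple_mixed_graph_def)
  ultimately obtain r where r: "linear_order_on (verts G) r" "?R \<inter> verts G \<times> verts G \<subseteq> r"
    using acyclic_linear_extension by blast
  have "dir H \<subseteq> verts G \<times> verts G" using simple_H V unfolding simple_mixed_graph_def by auto
  then have "dir H \<subseteq> r" using r(2) by blast
  moreover have "total_extension G r"
    using r by (auto simp: total_extension_iff)
  ultimately show ?thesis by blast
qed

end

theorem theorem17:
  fixes G H :: "'a mixed_graph"
  assumes "bidirected_graph G"
    and "minimally_oriented G H"
  shows "\<exists>r. total_extension G r \<and> H = Gmin G r"
proof -
  interpret bidirected G using assms(1) by unfold_locales
  show ?thesis
    using exists_total_extension minimally_oriented_eq_Gmin assms(2)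
    by (meson minimally_oriented_def)
qed

end
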